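(* Let $1\le q\le p<\infty$, let $(T,\mu)$ and $(S,\nu)$ be homogeneous spaces, let $\{W_t\}_{t\in T}$ and $\{V_s\}_{s\in S}$ be measurable families of Banach spaces over $(T,\mu,W)$ and $(S,\nu,V)$, let $\psi:S\to T$ be a measurable mapping that enjoys the Luzin $\mathcal N^{-1}$-property, and let $\{Q(s)\}_{s\in S}$, $Q(s):W_{\psi(s)}\to V_s$, be a measurable family of bounded linear operators. Let $\Gamma_\psi=\{(s,\psi(s)):s\in S\}$ be the graph of $\psi$ with the measure $\lambda(A)=\nu(\pi_S(A))$, where $\pi_S(A)=\{s\in S:(s,\psi(s))\in A\}$ for measurable $A\subset\Gamma_\psi$. Then the operator $$\mathcal C_\psi:\left(\int_T^\oplus W_t\,d\mu\right)_{L^p}\to\left(\int_S^\oplus V_s\,d\nu\right)_{L^q},\qquad \mathcal C_\psi[f](s)=Q(s)[f(\psi(s))],$$ is bounded if and only if the operator $$M_{\Gamma_\psi}:\left(\int_T^\oplus W_t\,d\mu\right)_{L^p}\to\left(\int_{\Gamma_\psi}^\oplus\widetilde V_{(s,t)}\,d\lambda\right)_{L^q},\qquad M_{\Gamma_\psi}[f](s,t)=P(s,t)[f(t)],$$ is bounded, where $P(s,t)=Q(s)$ for $(s,t)\in\Gamma_\psi$.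
   Context: Measurable family of Banach spaces: Let $W$ be a vector space. A family of semi-norms $\{\|\cdot\|_t\}_{t\in T}$ on $W$ is measurable if $t\mapsto\|w\|_t$ is measurable for each $w\in W$. $W_t$ is the completion of $W/\ker(\|\cdot\|_t)$ with respect to $\|\cdot\|_t$; the family $\{W_t\}$ is called a measurable family of Banach spaces over $(T,\mu,W)$. Similarly $\{V_s\}$ over $(S,\nu,V)$, with norms $\|\cdot\|_s$. Sections and direct integrals: A section of $\{W_t\}$ is a map $f$ with $f(t)\in W_t$ for all $t$. A simple section has the form $\sum_{k=1}^n\chi_{A_k}(t)w_k$ with $w_k\in W$, $A_k$ measurable. A section is measurable if it is the a.e. limit (in the norms of $W_t$) of a sequence of simple sections. The direct integral $\int_T^\oplus W_t\,d\mu$ is the space of a.e.-equivalence classes of measurable sections; $\left(\int_T^\oplus W_t\,d\mu\right)_{L^p}$ is the Banach space of those with finite norm $\left(\int_T\|f(t)\|_t^p\,d\mu\right)^{1/p}$. The same definitions apply to any measurable family over a measure space. On $\Gamma_\psi\subset S\times T$ (with the $\sigma$-algebra generated by the product $\sigma$-algebra of $S\times T$) one puts $\widetilde V_{(s,t)}=V_s$. Homogeneous space: a quasimetric space with a Borel measure such that (1) there is $c_1\ge1$ such that whenever balls $B(t_1,r)$, $B(t_2,r)$ intersect, $B(t_2,r)\subset B(t_1,c_1r)$; (2) balls of positive radius have positive finite measure and there is a constant $c_2$ with $\mu(B(t,c_1r))\le c_2\,\mu(B(t,r))$. Homogeneous spaces are assumed to be $\sigma$-finite measure spaces. Luzin $\mathcal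 N^{-1}$-property of $\psi$: the inverse image $\psi^{-1}(A)$ of every set $A\subset T$ of $\mu$-measure zero has $\nu$-measure zero. Measurable family $\{Q(s)\}$: a map $s\mapsto Q(s)\in\mathcal L(W_{\psi(s)},V_s)$, defined for $\nu$-almost all $s$, such that $s\mapsto Q(s)w$ is a measurable section of $\{V_s\}$ for every $w\in W$, and the operator norm $\|Q(s)\|$ is finite for $\nu$-a.e. $s$. Bounded: an operator between these normed spaces is bounded if there is a constant $K$ such that the norm of the image of $f$ is at most $K\|f\|$ for all $f$ in $\left(\int_T^\oplus W_t\,d\mu\right)_{L^p}$. *)

theory Defs
  imports "HOL-Analysis.Analysis"
begin

section \<open>Completion of a seminormed space\<close>

definition seminorm :: "('w::real_vector \<Rightarrow> real) \<Rightarrow> bool" where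
  "seminorm N \<longleftrightarrow>
     (\<forall>w. 0 \<le> N w) \<and> (\<forall>c w. N (c *\<^sub>R w) = \<bar>c\<bar> * N w) \<and> (\<forall>v w. N (v + w) \<le> N v + N w)"

text \<open>
  The completion of \<open>W / ker N\<close> is realised as the space of \<open>N\<close>-Cauchy sequences in \<open>W\<close> modulo
  the sequences converging to \<open>0\<close> in \<open>N\<close>. Vectors \<open>v\<close>, \<open>w\<close> with \<open>N (v - w) = 0\<close> have the same
  image, so the passage to \<open>W / ker N\<close> is part of the same quotient. Since all completions live in
  the one type \<open>(nat \<Rightarrow> 'w) set\<close>, a section of a family of them is an ordinary function.
\<close>

type_synonym 'w cmpl = "(nat \<Rightarrow> 'w) set"

definition cauchy_seqs :: "('w::real_vector \<Rightarrow> real) \<Rightarrow> (nat \<Rightarrow> 'w) set" where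
  "cauchy_seqs N = {x. \<forall>e>0. \<exists>k. \<forall>m\<ge>k. \<forall>n\<ge>k. N (x m - x n) < e}"

definition null_rel :: "('w::real_vector \<Rightarrow> real) \<Rightarrow> ((nat \<Rightarrow> 'w) \<times> (nat \<Rightarrow> 'w)) set" where
  "null_rel N = {(x, y). x \<in> cauchy_seqs N \<and> y \<in> cauchy_seqs N \<and>
                         (\<lambda>n. N (x n - y n)) \<longlonglongrightarrow> 0}"

definition banach_cmpl :: "('w::real_vector \<Rightarrow> real) \<Rightarrow> 'w cmpl set" where
  "banach_cmpl N = cauchy_seqs N // null_rel N"

definition cembed :: "('w::real_vector \<Rightarrow> real) \<Rightarrow> 'w \<Rightarrow> 'w cmpl" where
  "cembed N w = null_rel N `` {\<lambda>_. w}"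

definition cadd :: "('w::real_vector \<Rightarrow> real) \<Rightarrow> 'w cmpl \<Rightarrow> 'w cmpl \<Rightarrow> 'w cmpl" where
  "cadd N X Y = (\<Union>x\<in>X. \<Union>y\<in>Y. null_rel N `` {\<lambda>n. x n + y n})"

definition cscale :: "('w::real_vector \<Rightarrow> real) \<Rightarrow> real \<Rightarrow> 'w cmpl \<Rightarrow> 'w cmpl" where
  "cscale N c X = (\<Union>x\<in>X. null_rel N `` {\<lambda>n. c *\<^sub>R x n})"

definition cdiff :: "('w::real_vector \<Rightarrow> real) \<Rightarrow> 'w cmpl \<Rightarrow> 'w cmpl \<Rightarrow> 'w cmpl" where
  "cdiff N X Y = cadd N X (cscale N (-1) Y)"

definition cnorm :: "('w::real_vector \<Rightarrow> real) \<Rightarrow> 'w cmpl \<Rightarrow> real" where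
  "cnorm N X = (THE r. \<forall>x\<in>X. (\<lambda>n. N (x n)) \<longlonglongrightarrow> r)"

definition linear_cmpl ::
    "('w::real_vector \<Rightarrow> real) \<Rightarrow> ('v::real_vector \<Rightarrow> real) \<Rightarrow> ('w cmpl \<Rightarrow> 'v cmpl) \<Rightarrow> bool" where
  "linear_cmpl N N' L \<longleftrightarrow>
     (\<forall>X\<in>banach_cmpl N. L X \<in> banach_cmpl N') \<and>
     (\<forall>X\<in>banach_cmpl N. \<forall>Y\<in>banach_cmpl N. L (cadd N X Y) = cadd N' (L X) (L Y)) \<and>
     (\<forall>c. \<forall>X\<in>banach_cmpl N. L (cscale N c X) = cscale N' c (L X))"

definition op_norm ::
    "('w::real_vector \<Rightarrow> real) \<Rightarrow> ('v::real_vector \<Rightarrow> real) \<Rightarrow> ('w cmpl \<Rightarrow> 'v cmpl) \<Rightarrow> ennreal" where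
  "op_norm N N' L = (SUP X\<in>{X \<in> banach_cmpl N. cnorm N X \<le> 1}. ennreal (cnorm N' (L X)))"


section \<open>Measurable families, sections and direct integrals\<close>

text \<open>
  A family \<open>{W\<^sub>t}\<close> is given by its family of seminorms \<open>NW :: 't \<Rightarrow> 'w \<Rightarrow> real\<close>; the vector space \<open>W\<close>
  is the type \<open>'w\<close>.
\<close>

definition measurable_family :: "'t measure \<Rightarrow> ('t \<Rightarrow> 'w::real_vector \<Rightarrow> real) \<Rightarrow> bool" where
  "measurable_family M NW \<longleftrightarrow>
     (\<forall>t\<in>space M. seminorm (NW t)) \<and> (\<forall>w. (\<lambda>t. NW t w) \<in> borel_measurable M)"

definition is_section ::
    "'t measure \<Rightarrow> ('t \<Rightarrow> 'w::real_vector \<Rightarrow> real) \<Rightarrow> ('t \<Rightarrow> 'w cmpl) \<Rightarrow> bool" where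
  "is_section M NW f \<longleftrightarrow> (\<forall>t\<in>space M. f t \<in> banach_cmpl (NW t))"

definition simple_section ::
    "'t measure \<Rightarrow> ('t \<Rightarrow> 'w::real_vector \<Rightarrow> real) \<Rightarrow> ('t \<Rightarrow> 'w cmpl) \<Rightarrow> bool" where
  "simple_section M NW g \<longleftrightarrow>
     (\<exists>(n::nat) A w. (\<forall>k<n. A k \<in> sets M) \<and>
        g = (\<lambda>t. cembed (NW t) (\<Sum>k<n. indicat_real (A k) t *\<^sub>R w k)))"

definition measurable_section ::
    "'t measure \<Rightarrow> ('t \<Rightarrow> 'w::real_vector \<Rightarrow> real) \<Rightarrow> ('t \<Rightarrow> 'w cmpl) \<Rightarrow> bool" where
  "measurable_section M NW f \<longleftrightarrow> is_section M NW f \<and>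
     (\<exists>g. (\<forall>n. simple_section M NW (g n)) \<and>
        (AE t in M. (\<lambda>n. cnorm (NW t) (cdiff (NW t) (g n t) (f t))) \<longlonglongrightarrow> 0))"

text \<open>
  The class of all measurable sections agreeing a.e. with \<open>g\<close>. Here \<open>g\<close> itself need not be a section
  on a null set, which is how a.e. defined maps are treated; if \<open>g\<close> agrees a.e. with no measurable
  section, then the result is empty and hence not an element of a direct integral.
\<close>

definition ae_class ::
    "'t measure \<Rightarrow> ('t \<Rightarrow> 'w::real_vector \<Rightarrow> real) \<Rightarrow> ('t \<Rightarrow> 'w cmpl) \<Rightarrow> ('t \<Rightarrow> 'w cmpl) set" where
  "ae_class M NW g = {f. measurable_section M NW f \<and> (AE t in M. f t = g t)}"

definition section_integral ::
    "real \<Rightarrow> 't measure \<Rightarrow> ('t \<Rightarrow> 'w::real_vector \<Rightarrow> real) \<Rightarrow> ('t \<Rightarrow> 'w cmpl) \<Rightarrow> ennreal" where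
  "section_integral p M NW f = (\<integral>\<^sup>+ t. ennreal (cnorm (NW t) (f t) powr p) \<partial>M)"

definition direct_integral_Lp ::
    "real \<Rightarrow> 't measure \<Rightarrow> ('t \<Rightarrow> 'w::real_vector \<Rightarrow> real) \<Rightarrow> ('t \<Rightarrow> 'w cmpl) set set" where
  "direct_integral_Lp p M NW =
     {ae_class M NW f | f. measurable_section M NW f \<and> section_integral p M NW f < \<infinity>}"

definition direct_integral_norm ::
    "real \<Rightarrow> 't measure \<Rightarrow> ('t \<Rightarrow> 'w::real_vector \<Rightarrow> real) \<Rightarrow> ('t \<Rightarrow> 'w cmpl) set \<Rightarrow> real" where
  "direct_integral_norm p M NW F =
     (THE r. \<forall>f\<in>F. r = enn2real (section_integral p M NW f) powr (1 / p))"

text \<open>The operator on a.e.-classes induced by an operator \<open>H\<close> on representatives.\<close>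

definition lift_op ::
    "'s measure \<Rightarrow> ('s \<Rightarrow> 'v::real_vector \<Rightarrow> real) \<Rightarrow> (('t \<Rightarrow> 'w cmpl) \<Rightarrow> ('s \<Rightarrow> 'v cmpl)) \<Rightarrow>
     ('t \<Rightarrow> 'w cmpl) set \<Rightarrow> ('s \<Rightarrow> 'v cmpl) set" where
  "lift_op M' NV H F = (\<Union>f\<in>F. ae_class M' NV (H f))"

definition bounded_operator ::
    "real \<Rightarrow> 't measure \<Rightarrow> ('t \<Rightarrow> 'w::real_vector \<Rightarrow> real) \<Rightarrow>
     real \<Rightarrow> 's measure \<Rightarrow> ('s \<Rightarrow> 'v::real_vector \<Rightarrow> real) \<Rightarrow>
     (('t \<Rightarrow> 'w cmpl) set \<Rightarrow> ('s \<Rightarrow> 'v cmpl) set) \<Rightarrow> bool" where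
  "bounded_operator p M NW q M' NV A \<longleftrightarrow>
     (\<exists>K. \<forall>F\<in>direct_integral_Lp p M NW.
        A F \<in> direct_integral_Lp q M' NV \<and>
        direct_integral_norm q M' NV (A F) \<le> K * direct_integral_norm p M NW F)"


section \<open>Spaces of homogeneous type\<close>

definition quasimetric_on :: "'t set \<Rightarrow> ('t \<Rightarrow> 't \<Rightarrow> real) \<Rightarrow> bool" where
  "quasimetric_on X d \<longleftrightarrow>
     (\<forall>x\<in>X. \<forall>y\<in>X. 0 \<le> d x y \<and> (d x y = 0 \<longleftrightarrow> x = y) \<and> d x y = d y x) \<and>
     (\<exists>c. \<forall>x\<in>X. \<forall>y\<in>X. \<forall>z\<in>X. d x z \<le> c * (d x y + d y z))"

definition qball :: "'t set \<Rightarrow> ('t \<Rightarrow> 't \<Rightarrow> real) \<Rightarrow> 't \<Rightarrow> real \<Rightarrow> 't set" where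
  "qball X d t r = {y\<in>X. d t y < r}"

text \<open>Balls of a quasimetric need not be open.\<close>

definition qopen :: "'t set \<Rightarrow> ('t \<Rightarrow> 't \<Rightarrow> real) \<Rightarrow> 't set \<Rightarrow> bool" where
  "qopen X d U \<longleftrightarrow> U \<subseteq> X \<and> (\<forall>x\<in>U. \<exists>r>0. qball X d x r \<subseteq> U)"

definition homogeneous_space :: "('t \<Rightarrow> 't \<Rightarrow> real) \<Rightarrow> 't measure \<Rightarrow> bool" where
  "homogeneous_space d M \<longleftrightarrow>
     quasimetric_on (space M) d \<and>
     sets M = sigma_sets (space M) {U. qopen (space M) d U} \<and>
     sigma_finite_measure M \<and>
     (\<forall>t\<in>space M. \<forall>r>0. qball (space M) d t r \<in> sets M \<and>
        0 < emeasure M (qball (space M) d t r) \<and> emeasure M (qball (space M) d t r) < \<infinity>) \<and>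
     (\<exists>c1\<ge>1.
        (\<forall>t1\<in>space M. \<forall>t2\<in>space M. \<forall>r>0.
           qball (space M) d t1 r \<inter> qball (space M) d t2 r \<noteq> {} \<longrightarrow>
           qball (space M) d t2 r \<subseteq> qball (space M) d t1 (c1 * r)) \<and>
        (\<exists>c2::real. \<forall>t\<in>space M. \<forall>r>0.
           emeasure M (qball (space M) d t (c1 * r)) \<le> ennreal c2 * emeasure M (qball (space M) d t r)))"


section \<open>Weighted composition and multiplication on the graph\<close>

definition luzin_inverse :: "'s measure \<Rightarrow> 't measure \<Rightarrow> ('s \<Rightarrow> 't) \<Rightarrow> bool" where
  "luzin_inverse \<nu> \<mu> \<psi> \<longleftrightarrow> (\<forall>A\<in>null_sets \<mu>. \<psi> -` A \<inter> space \<nu> \<in> null_sets \<nu>)"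

text \<open>
  \<open>Q s\<close> is only required to be an operator for almost all \<open>s\<close>, so \<open>s \<mapsto> Q s w\<close> is an a.e. defined
  section, and its measurability means that it agrees a.e. with a measurable section.
\<close>

definition measurable_operator_family ::
    "'s measure \<Rightarrow> ('s \<Rightarrow> 't) \<Rightarrow> ('t \<Rightarrow> 'w::real_vector \<Rightarrow> real) \<Rightarrow> ('s \<Rightarrow> 'v::real_vector \<Rightarrow> real) \<Rightarrow>
     ('s \<Rightarrow> 'w cmpl \<Rightarrow> 'v cmpl) \<Rightarrow> bool" where
  "measurable_operator_family \<nu> \<psi> NW NV Q \<longleftrightarrow>
     (AE s in \<nu>. linear_cmpl (NW (\<psi> s)) (NV s) (Q s)) \<and>
     (\<forall>w. \<exists>h. measurable_section \<nu> NV h \<and> (AE s in \<nu>. h s = Q s (cembed (NW (\<psi> s)) w))) \<and>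
     (AE s in \<nu>. op_norm (NW (\<psi> s)) (NV s) (Q s) < \<infinity>)"

definition comp_op ::
    "('s \<Rightarrow> 't) \<Rightarrow> ('s \<Rightarrow> 'w cmpl \<Rightarrow> 'v cmpl) \<Rightarrow> ('t \<Rightarrow> 'w cmpl) \<Rightarrow> ('s \<Rightarrow> 'v cmpl)" where
  "comp_op \<psi> Q f = (\<lambda>s. Q s (f (\<psi> s)))"

definition graph_mult_op ::
    "('s \<times> 't \<Rightarrow> 'w cmpl \<Rightarrow> 'v cmpl) \<Rightarrow> ('t \<Rightarrow> 'w cmpl) \<Rightarrow> ('s \<times> 't \<Rightarrow> 'v cmpl)" where
  "graph_mult_op P f = (\<lambda>(s, t). P (s, t) (f t))"

definition map_graph :: "'s measure \<Rightarrow> ('s \<Rightarrow> 't) \<Rightarrow> ('s \<times> 't) set" where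
  "map_graph \<nu> \<psi> = {(s, \<psi> s) | s. s \<in> space \<nu>}"

text \<open>
  The graph carries the trace of the product \<open>\<sigma>\<close>-algebra, and \<open>\<lambda>(A) = \<nu> {s. (s, \<psi> s) \<in> A}\<close>, which
  is the value of the push-forward of \<open>\<nu>\<close> under \<open>s \<mapsto> (s, \<psi> s)\<close>.
\<close>

definition graph_measure :: "'s measure \<Rightarrow> 't measure \<Rightarrow> ('s \<Rightarrow> 't) \<Rightarrow> ('s \<times> 't) measure" where
  "graph_measure \<nu> \<mu> \<psi> =
     distr \<nu> (restrict_space (\<nu> \<Otimes>\<^sub>M \<mu>) (map_graph \<nu> \<psi>)) (\<lambda>s. (s, \<psi> s))"

end

theory Submission
  imports Defs
begin

text \<open>
  The map \<open>s \<mapsto> (s, \<psi> s)\<close> is an isomorphism of measure spaces from \<open>S\<close> onto the graph, with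
  inverse the first projection. Composition with it identifies the direct integral over the graph
  with the one over \<open>S\<close>, preserves norms, and turns multiplication on the graph into the weighted
  composition operator.
\<close>

text \<open>\<open>f\<close> is arbitrary, so \<open>nn_integral_distr\<close> does not apply to it.
  It does apply to each simple \<open>u\<close> below \<open>f\<close>, and the integral is the
  supremum over such \<open>u\<close>. Only an inequality results, since the pull-back of
  \<open>f\<close> may have simple minorants that do not come from \<open>N\<close>.\<close>

lemma nn_integral_distr_le:
  assumes "r \<in> measurable M N"
  shows "(\<integral>\<^sup>+ y. f y \<partial>distr M N r) \<le> (\<integral>\<^sup>+ x. f (r x) \<partial>M)"
  unfolding nn_integral_def[of "distr M N r"]
proof (rule SUP_least)
  fix u assume "u \<in> {u. simple_function (distr M N r) u \<and> u \<le> f}"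
  then have u: "simple_function (distr M N r) u" and le: "u \<le> f" by auto
  have "integral\<^sup>S (distr M N r) u = (\<integral>\<^sup>+ y. u y \<partial>distr M N r)"
    by (simp add: nn_integral_eq_simple_integral u)
  also have "\<dots> = (\<integral>\<^sup>+ x. u (r x) \<partial>M)"
    using borel_measurable_simple_function[OF u] by (simp add: nn_integral_distr assms)
  also have "\<dots> \<le> (\<integral>\<^sup>+ x. f (r x) \<partial>M)"
    using le by (auto intro: nn_integral_mono simp: le_fun_def)
  finally show "integral\<^sup>S (distr M N r) u \<le> (\<integral>\<^sup>+ x. f (r x) \<partial>M)" .
qed

lemma measurable_section_cong:
  assumes "\<And>t. t \<in> space M \<Longrightarrow> f t = g t" "measurable_section M NW f"
  shows "measurable_section M NW g"
proof -
  obtain u where u: "\<And>n. simple_section M NW (u n)"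
    and lim: "AE t in M. (\<lambda>n. cnorm (NW t) (cdiff (NW t) (u n t) (f t))) \<longlonglongrightarrow> 0"
    using assms(2) by (auto simp: measurable_section_def)
  have "AE t in M. (\<lambda>n. cnorm (NW t) (cdiff (NW t) (u n t) (g t))) \<longlonglongrightarrow> 0"
    using lim AE_space by eventually_elim (simp add: assms(1))
  with u assms show ?thesis
    by (auto simp: measurable_section_def is_section_def)
qed

lemma simple_section_compose:
  assumes r: "r \<in> measurable M N" and u: "simple_section N NW u"
  obtains v where "simple_section M (\<lambda>x. NW (r x)) v" "\<And>x. x \<in> space M \<Longrightarrow> v x = u (r x)"
proof -
  obtain n :: nat and A w where A: "\<forall>k<n. A k \<in> sets N"
    and u_def: "u = (\<lambda>t. cembed (NW t) (\<Sum>k<n. indicat_real (A k) t *\<^sub>R w k))"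
    using u by (auto simp: simple_section_def)
  \<comment> \<open>Only the part of the preimage inside \<open>space M\<close> is measurable, so
    the new section agrees with \<open>u\<close> after \<open>r\<close> on \<open>space M\<close>
    alone.\<close>
  let ?B = "\<lambda>k. r -` A k \<inter> space M"
  let ?v = "\<lambda>x. cembed (NW (r x)) (\<Sum>k<n. indicat_real (?B k) x *\<^sub>R w k)"
  have "\<forall>k<n. ?B k \<in> sets M"
    using A r by (auto intro: measurable_sets)
  then have "simple_section M (\<lambda>x. NW (r x)) ?v"
    unfolding simple_section_def by (intro exI[of _ n] exI[of _ ?B] exI[of _ w]) simp
  moreover have "?v x = u (r x)" if "x \<in> space M" for x
    using that by (simp add: u_def indicator_def)
  ultimately show thesis using that by blast
qed

text \<open>The fibre over \<open>x\<close> is the one over \<open>r x\<close>, so the approximating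
  simple sections pull back with unchanged norms. The condition \<open>distr M N r = N\<close> makes
  preimages of null sets null, which preserves a.e. convergence.\<close>

lemma measurable_section_compose:
  assumes r: "r \<in> measurable M N" "distr M N r = N" and f: "measurable_section N NW f"
  shows "measurable_section M (\<lambda>x. NW (r x)) (\<lambda>x. f (r x))"
proof -
  obtain u where u: "\<And>n. simple_section N NW (u n)"
    and lim: "AE t in N. (\<lambda>n. cnorm (NW t) (cdiff (NW t) (u n t) (f t))) \<longlonglongrightarrow> 0"
    using f by (auto simp: measurable_section_def)
  have "\<exists>v. simple_section M (\<lambda>x. NW (r x)) v \<and> (\<forall>x\<in>space M. v x = u n (r x))" for n
    by (rule simple_section_compose[OF r(1) u[of n]]) blast
  then obtain v where v: "\<And>n. simple_section M (\<lambda>x. NW (r x)) (v n)"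
    and vu: "\<And>n x. x \<in> space M \<Longrightarrow> v n x = u n (r x)"
    by metis
  have "AE x in M. (\<lambda>n. cnorm (NW (r x)) (cdiff (NW (r x)) (u n (r x)) (f (r x)))) \<longlonglongrightarrow> 0"
    using lim by (intro AE_distrD[OF r(1)]) (simp only: r(2))
  then have "AE x in M. (\<lambda>n. cnorm (NW (r x)) (cdiff (NW (r x)) (v n x) (f (r x)))) \<longlonglongrightarrow> 0"
    using AE_space by eventually_elim (simp add: vu)
  moreover have "is_section M (\<lambda>x. NW (r x)) (\<lambda>x. f (r x))"
    using f measurable_space[OF r(1)] by (auto simp: measurable_section_def is_section_def)
  ultimately show ?thesis
    using v by (auto simp: measurable_section_def)
qed

text \<open>
  Sections are total functions, so their values off \<open>space N\<close> matter for equality of classes: only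
  \<open>h \<circ> g = id\<close> is an identity of functions.
\<close>

locale measure_space_iso =
  fixes M :: "'a measure" and N :: "'b measure" and g :: "'a \<Rightarrow> 'b" and h :: "'b \<Rightarrow> 'a"
  assumes g: "g \<in> measurable M N" and h: "h \<in> measurable N M"
    and distr_g: "distr M N g = N"
    and hg [simp]: "h (g x) = x"
    and gh: "y \<in> space N \<Longrightarrow> g (h y) = y"
begin

lemma distr_h: "distr N M h = M"
proof -
  have "distr N M h = distr (distr M N g) M h" by (simp add: distr_g)
  also have "\<dots> = distr M M (h \<circ> g)" using g h by (simp add: distr_distr)
  also have "h \<circ> g = (\<lambda>x. x)" by auto
  finally show ?thesis by simp
qed

text \<open>Pulling an a.e. statement back along a measure-preserving map needs no measurability of
  \<open>R\<close>; the converse is the same pull-back along \<open>h\<close>.\<close>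

lemma AE_iso: "(AE y in N. R y) \<longleftrightarrow> (AE x in M. R (g x))"
proof
  assume "AE y in N. R y"
  then show "AE x in M. R (g x)" using AE_distrD[OF g] distr_g by metis
next
  assume "AE x in M. R (g x)"
  then have "AE y in N. R (g (h y))" using AE_distrD[OF h, of "\<lambda>x. R (g x)"] distr_h by metis
  then show "AE y in N. R y" using AE_space by eventually_elim (simp add: gh)
qed

text \<open>The one-sided estimate, applied to \<open>g\<close> and to \<open>h\<close>, gives
  equality even for non-measurable \<open>f\<close>. Norms of sections can thus be integrated
  without first proving them measurable.\<close>

lemma nn_integral_iso: "(\<integral>\<^sup>+ y. f y \<partial>N) = (\<integral>\<^sup>+ x. f (g x) \<partial>M)"
proof (rule antisym)
  show "(\<integral>\<^sup>+ y. f y \<partial>N) \<le> (\<integral>\<^sup>+ x. f (g x) \<partial>M)"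
    using nn_integral_distr_le[OF g, of f] by (simp add: distr_g)
  have "(\<integral>\<^sup>+ x. f (g x) \<partial>M) \<le> (\<integral>\<^sup>+ y. f (g (h y)) \<partial>N)"
    using nn_integral_distr_le[OF h, of "\<lambda>x. f (g x)"] by (simp add: distr_h)
  also have "\<dots> = (\<integral>\<^sup>+ y. f y \<partial>N)" by (rule nn_integral_cong) (simp add: gh)
  finally show "(\<integral>\<^sup>+ x. f (g x) \<partial>M) \<le> (\<integral>\<^sup>+ y. f y \<partial>N)" .
qed

lemma section_integral_iso:
  "section_integral p N (\<lambda>y. NV (h y)) f = section_integral p M NV (\<lambda>x. f (g x))"
  by (simp add: section_integral_def nn_integral_iso)

lemma measurable_section_iso:
  "measurable_section N (\<lambda>y. NV (h y)) f \<longleftrightarrow> measurable_section M NV (\<lambda>x. f (g x))"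
proof
  assume "measurable_section N (\<lambda>y. NV (h y)) f"
  from measurable_section_compose[OF g distr_g this]
  show "measurable_section M NV (\<lambda>x. f (g x))" by simp
next
  assume "measurable_section M NV (\<lambda>x. f (g x))"
  \<comment> \<open>This yields the section \<open>f (g (h y))\<close>, which is known to equal
    \<open>f y\<close> only on \<open>space N\<close>.\<close>
  from measurable_section_compose[OF h distr_h this]
  show "measurable_section N (\<lambda>y. NV (h y)) f"
    by (rule measurable_section_cong[rotated]) (simp add: gh)
qed

lemma ae_class_iso:
  assumes "\<And>x. x \<in> space M \<Longrightarrow> V (g x) = U x"
  shows "f \<in> ae_class N (\<lambda>y. NV (h y)) V \<longleftrightarrow> (\<lambda>x. f (g x)) \<in> ae_class M NV U"
proof -
  have "(AE y in N. f y = V y) \<longleftrightarrow> (AE x in M. f (g x) = U x)"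
    using assms by (subst AE_iso) (auto intro!: AE_cong)
  then show ?thesis by (simp add: ae_class_def measurable_section_iso)
qed

text \<open>Every \<open>u\<close> in \<open>X\<close> is \<open>f\<close> after \<open>g\<close>
  for \<open>f\<close> equal to \<open>u\<close> after \<open>h\<close>. Hence both descriptions
  \<open>THE r\<close> have the same defining predicate, and neither existence nor uniqueness of
  \<open>r\<close> is at stake: \<open>X\<close> may be any set of functions.\<close>

lemma direct_integral_norm_iso:
  "direct_integral_norm p N (\<lambda>y. NV (h y)) {f. (\<lambda>x. f (g x)) \<in> X} = direct_integral_norm p M NV X"
proof -
  have "(\<forall>f. (\<lambda>x. f (g x)) \<in> X \<longrightarrow> R (\<lambda>x. f (g x))) \<longleftrightarrow> (\<forall>f\<in>X. R f)" for R
  proof (intro iffI ballI)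
    fix f assume *: "\<forall>f. (\<lambda>x. f (g x)) \<in> X \<longrightarrow> R (\<lambda>x. f (g x))" and "f \<in> X"
    with *[rule_format, of "\<lambda>y. f (h y)"] show "R f" by simp
  qed blast
  from this[of "\<lambda>f. r = enn2real (section_integral p M NV f) powr (1 / p)" for r]
  show ?thesis by (simp add: direct_integral_norm_def section_integral_iso)
qed

lemma direct_integral_Lp_iso:
  "{f. (\<lambda>x. f (g x)) \<in> X} \<in> direct_integral_Lp p N (\<lambda>y. NV (h y)) \<longleftrightarrow>
     X \<in> direct_integral_Lp p M NV" (is "?Y \<in> _ \<longleftrightarrow> _")
proof
  assume "?Y \<in> direct_integral_Lp p N (\<lambda>y. NV (h y))"
  then obtain f where Y: "?Y = ae_class N (\<lambda>y. NV (h y)) f"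
    and f: "measurable_section N (\<lambda>y. NV (h y)) f"
      "section_integral p N (\<lambda>y. NV (h y)) f < \<infinity>"
    by (auto simp: direct_integral_Lp_def)
  have "u \<in> X \<longleftrightarrow> u \<in> ae_class M NV (\<lambda>x. f (g x))" for u
  proof -
    \<comment> \<open>\<open>X\<close> is recovered from \<open>?Y\<close> by testing
      \<open>u\<close> after \<open>h\<close>, because \<open>h (g x) = x\<close> for every
      \<open>x\<close>.\<close>
    have "u \<in> X \<longleftrightarrow> (\<lambda>y. u (h y)) \<in> ?Y" by simp
    also have "\<dots> \<longleftrightarrow> u \<in> ae_class M NV (\<lambda>x. f (g x))"
      unfolding Y by (subst ae_class_iso[where U = "\<lambda>x. f (g x)"]) simp_all
    finally show ?thesis .
  qed
  then have "X = ae_class M NV (\<lambda>x. f (g x))" by blast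
  with f show "X \<in> direct_integral_Lp p M NV"
    by (auto simp: direct_integral_Lp_def measurable_section_iso section_integral_iso)
next
  assume "X \<in> direct_integral_Lp p M NV"
  then obtain f where X: "X = ae_class M NV f"
    and f: "measurable_section M NV f" "section_integral p M NV f < \<infinity>"
    by (auto simp: direct_integral_Lp_def)
  have "?Y = ae_class N (\<lambda>y. NV (h y)) (\<lambda>y. f (h y))"
    using ae_class_iso[of "\<lambda>y. f (h y)" f] by (auto simp: X)
  with f show "?Y \<in> direct_integral_Lp p N (\<lambda>y. NV (h y))"
    unfolding direct_integral_Lp_def mem_Collect_eq
    by (intro exI[of _ "\<lambda>y. f (h y)"]) (simp add: measurable_section_iso section_integral_iso)
qed

text \<open>The two image classes correspond under composition with \<open>g\<close>, so membership
  and norm agree for each \<open>F\<close> and the same \<open>K\<close> serves both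
  operators.\<close>

lemma bounded_operator_iso:
  assumes "\<And>f x. x \<in> space M \<Longrightarrow> H' f (g x) = H f x"
  shows "bounded_operator p L NW q N (\<lambda>y. NV (h y)) (lift_op N (\<lambda>y. NV (h y)) H') \<longleftrightarrow>
    bounded_operator p L NW q M NV (lift_op M NV H)"
proof -
  have "lift_op N (\<lambda>y. NV (h y)) H' F = {f. (\<lambda>x. f (g x)) \<in> lift_op M NV H F}" for F
    using ae_class_iso[of "H' f" "H f" for f] by (simp add: lift_op_def assms set_eq_iff)
  then show ?thesis
    unfolding bounded_operator_def by (simp only: direct_integral_Lp_iso direct_integral_norm_iso)
qed

end

lemma measure_space_iso_graph:
  assumes "\<psi> \<in> measurable \<nu> \<mu>"
  shows "measure_space_iso \<nu> (graph_measure \<nu> \<mu> \<psi>) (\<lambda>s. (s, \<psi> s)) fst"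
proof
  let ?R = "restrict_space (\<nu> \<Otimes>\<^sub>M \<mu>) (map_graph \<nu> \<psi>)"
  have sets: "sets (graph_measure \<nu> \<mu> \<psi>) = sets ?R"
    by (simp add: graph_measure_def)
  show g: "(\<lambda>s. (s, \<psi> s)) \<in> measurable \<nu> (graph_measure \<nu> \<mu> \<psi>)"
    unfolding measurable_cong_sets[OF refl sets] using assms
    by (intro measurable_restrict_space2) (auto simp: map_graph_def)
  show "fst \<in> measurable (graph_measure \<nu> \<mu> \<psi>) \<nu>"
    unfolding measurable_cong_sets[OF sets refl]
    by (intro measurable_restrict_space1) simp
  \<comment> \<open>A push-forward depends on its target only through the \<sigma>-algebra, and
    \<open>graph_measure\<close> has that of the restricted product.\<close>
  show "distr \<nu> (graph_measure \<nu> \<mu> \<psi>) (\<lambda>s. (s, \<psi> s)) = graph_measure \<nu> \<mu> \<psi>"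
    unfolding graph_measure_def by (intro distr_cong) simp_all
  show "(fst y, \<psi> (fst y)) = y" if "y \<in> space (graph_measure \<nu> \<mu> \<psi>)" for y
    using that by (auto simp: graph_measure_def space_restrict_space map_graph_def)
qed simp

theorem lemma5p2:
  fixes p q :: real
    and \<mu> :: "'t measure" and dT :: "'t \<Rightarrow> 't \<Rightarrow> real"
    and \<nu> :: "'s measure" and dS :: "'s \<Rightarrow> 's \<Rightarrow> real"
    and NW :: "'t \<Rightarrow> 'w::real_vector \<Rightarrow> real"
    and NV :: "'s \<Rightarrow> 'v::real_vector \<Rightarrow> real"
    and \<psi> :: "'s \<Rightarrow> 't"
    and Q :: "'s \<Rightarrow> 'w cmpl \<Rightarrow> 'v cmpl"
    and P :: "'s \<times> 't \<Rightarrow> 'w cmpl \<Rightarrow> 'v cmpl"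
  assumes "1 \<le> q" and "q \<le> p"
    and "homogeneous_space dT \<mu>"
    and "homogeneous_space dS \<nu>"
    and "measurable_family \<mu> NW"
    and "measurable_family \<nu> NV"
    and "\<psi> \<in> measurable \<nu> \<mu>"
    and "luzin_inverse \<nu> \<mu> \<psi>"
    and "measurable_operator_family \<nu> \<psi> NW NV Q"
    and "\<And>s t. (s, t) \<in> map_graph \<nu> \<psi> \<Longrightarrow> P (s, t) = Q s"
  shows
    "bounded_operator p \<mu> NW q \<nu> NV (lift_op \<nu> NV (comp_op \<psi> Q)) \<longleftrightarrow>
     bounded_operator p \<mu> NW q (graph_measure \<nu> \<mu> \<psi>) (\<lambda>(s, t). NV s)
       (lift_op (graph_measure \<nu> \<mu> \<psi>) (\<lambda>(s, t). NV s) (graph_mult_op P))"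
proof -
  interpret measure_space_iso \<nu> "graph_measure \<nu> \<mu> \<psi>" "\<lambda>s. (s, \<psi> s)" fst
    using \<open>\<psi> \<in> measurable \<nu> \<mu>\<close> by (rule measure_space_iso_graph)
  \<comment> \<open>\<open>P\<close> is prescribed on the graph only, hence the restriction to
    \<open>space \<nu>\<close>.\<close>
  have "graph_mult_op P f (s, \<psi> s) = comp_op \<psi> Q f s" if "s \<in> space \<nu>" for f s
    using that assms(10) by (auto simp: graph_mult_op_def comp_op_def map_graph_def)
  then show ?thesis
    using bounded_operator_iso[of "graph_mult_op P" "comp_op \<psi> Q" p \<mu> NW q NV]
    \<comment> \<open>Unfolding the pair pattern brings the family on the graph into the form
      \<open>NV (fst y)\<close>, that is, \<open>NV (h y)\<close>.\<close>
    by (simp add: case_prod_unfold)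
qed

end
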